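(* Let $\mathcal{U}$ be an uncertainty set satisfying Assumption 1, let $\hat{\mathcal{U}}\subseteq\mathbb{R}^m_+$ dominate $\mathcal{U}$, and let $\beta=\beta(\mathcal{U},\hat{\mathcal{U}})$ be the scaling factor of $(\mathcal{U},\hat{\mathcal{U}})$. Let $z_{AR}(\mathcal{U})$ and $z_{AR}(\hat{\mathcal{U}})$ be the optimal values of the two-stage adjustable robust problem over $\mathcal{U}$ and $\hat{\mathcal{U}}$ respectively (with the same data $A,B,c,d$). Then $$z_{AR}(\mathcal{U})\le z_{AR}(\hat{\mathcal{U}})\le \beta\cdot z_{AR}(\mathcal{U}).$$
   Context: Vector inequalities are componentwise; $e_i$ is the $i$-th standard basis vector of $\mathbb{R}^m$. Two-stage adjustable robust problem $\Pi_{AR}(\mathcal{S})$: the data are $A\in\mathbb{R}_+^{m\times n}$, $B\in\mathbb{R}^{m\times n}$, $c,d\in\mathbb{R}^n_+$. For a set $\mathcal{S}\subseteq\mathbb{R}^m_+$, a feasible solution is a pair $(x,y(\cdot))$ with $x\in\mathbb{R}^n_+$, $y:\mathcal{S}\to\mathbb{R}^n_+$ and $Ax+By(h)\ge h$ for all $h\in\mathcal{S}$; the optimal value $z_{AR}(\mathcal{S})$ is the minimum (infimum) over feasible solutions of the worst-case cost $c^Tx+\max_{h\in\mathcal{S}}d^Ty(h)$ (max read as supremum; value $+\infty$ if infeasible). Assumption 1 on $\mathcal{U}$: $\mathcal{U}\subseteq[0,1]^m$ is convex, full-dimensional, $e_i\in\mathcal{U}$ for all $i=1,\dots,m$, and down-monotone,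 i.e. $h\in\mathcal{U}$ and $0\le h'\le h$ imply $h'\in\mathcal{U}$. Domination: $\hat{\mathcal{U}}\subseteq\mathbb{R}^m_+$ dominates $\mathcal{U}\subseteq\mathbb{R}^m_+$ if for every $h\in\mathcal{U}$ there is $\hat h\in\hat{\mathcal{U}}$ with $\hat h\ge h$. Scaling factor: $\beta(\mathcal{U},\hat{\mathcal{U}})=\min\{\beta>0:\hat{\mathcal{U}}\subseteq\beta\cdot\mathcal{U}\}$; the pair $(\mathcal{U},\hat{\mathcal{U}})$ is taken to be such that this minimum exists. *)

theory Defs
  imports "HOL-Analysis.Analysis"
begin

text \<open>On \<^typ>\<open>real ^ 'm\<close> the order \<open>\<le>\<close> is the componentwise one, and \<open>1\<close> is the all-ones vector.\<close>

text \<open>The second-stage policy \<open>y\<close> is a total function; only its values on \<open>S\<close> are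
  constrained or used.\<close>

definition ar_feasible ::
  "real ^ 'n ^ 'm \<Rightarrow> real ^ 'n ^ 'm \<Rightarrow> (real ^ 'm) set \<Rightarrow> real ^ 'n \<Rightarrow> (real ^ 'm \<Rightarrow> real ^ 'n) \<Rightarrow> bool"
  where "ar_feasible A B S x y \<longleftrightarrow>
    0 \<le> x \<and> (\<forall>h\<in>S. 0 \<le> y h \<and> h \<le> A *v x + B *v y h)"

definition ar_cost ::
  "real ^ 'n \<Rightarrow> real ^ 'n \<Rightarrow> (real ^ 'm) set \<Rightarrow> real ^ 'n \<Rightarrow> (real ^ 'm \<Rightarrow> real ^ 'n) \<Rightarrow> ereal"
  where "ar_cost c d S x y = ereal (c \<bullet> x) + (SUP h\<in>S. ereal (d \<bullet> y h))"

text \<open>The infimum is taken in \<^typ>\<open>ereal\<close>, so an infeasible problem has value \<open>\<infinity>\<close>.\<close>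

definition z_AR ::
  "real ^ 'n ^ 'm \<Rightarrow> real ^ 'n ^ 'm \<Rightarrow> real ^ 'n \<Rightarrow> real ^ 'n \<Rightarrow> (real ^ 'm) set \<Rightarrow> ereal"
  where "z_AR A B c d S = (INF (x, y)\<in>{(x, y). ar_feasible A B S x y}. ar_cost c d S x y)"

definition down_monotone :: "(real ^ 'm) set \<Rightarrow> bool"
  where "down_monotone U \<longleftrightarrow> (\<forall>h\<in>U. \<forall>h'. 0 \<le> h' \<and> h' \<le> h \<longrightarrow> h' \<in> U)"

definition assumption1 :: "(real ^ 'm) set \<Rightarrow> bool"
  where "assumption1 U \<longleftrightarrow>
    U \<subseteq> {0..1} \<and> convex U \<and> aff_dim U = int DIM(real ^ 'm) \<and>
    (\<forall>i. axis i 1 \<in> U) \<and> down_monotone U"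

definition dominates :: "(real ^ 'm) set \<Rightarrow> (real ^ 'm) set \<Rightarrow> bool"
  where "dominates Uh U \<longleftrightarrow> (\<forall>h\<in>U. \<exists>hh\<in>Uh. h \<le> hh)"

definition scalings :: "(real ^ 'm) set \<Rightarrow> (real ^ 'm) set \<Rightarrow> real set"
  where "scalings U Uh = {b. 0 < b \<and> Uh \<subseteq> (\<lambda>h. b *\<^sub>R h) ` U}"

text \<open>\<open>LEAST\<close> is the minimum of \<open>scalings U Uh\<close> when that exists, and is unspecified otherwise.\<close>

definition scaling_factor :: "(real ^ 'm) set \<Rightarrow> (real ^ 'm) set \<Rightarrow> real"
  where "scaling_factor U Uh = (LEAST b. b \<in> scalings U Uh)"

end

theory Submission
  imports Defs
begin

text \<open>Composing a policy for \<open>Uh\<close> with a choice of dominating points gives a policy for \<open>U\<close> of no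
  larger cost, and a solution \<open>(x, y)\<close> over \<open>U\<close> rescales to the solution
  \<open>(\<beta> x, h \<mapsto> \<beta> y (h / \<beta>))\<close> over any subset of \<open>\<beta> U\<close>, at \<open>\<beta>\<close> times the cost.\<close>

lemma z_AR_le_cost: "ar_feasible A B S x y \<Longrightarrow> z_AR A B c d S \<le> ar_cost c d S x y"
  unfolding z_AR_def by (rule INF_lower2[of "(x, y)"]) auto

text \<open>Infeasibility requires no separate case: the premise is then vacuous and the infimum
  over the empty set is \<open>\<infinity>\<close>.\<close>

lemma z_AR_greatest:
  assumes "\<And>x y. ar_feasible A B S x y \<Longrightarrow> z \<le> ar_cost c d S x y"
  shows "z \<le> z_AR A B c d S"
  unfolding z_AR_def by (rule INF_greatest) (auto intro: assms)

lemma z_AR_dominates_mono: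
  fixes U Uh :: "(real ^ 'm) set"
  assumes "dominates Uh U"
  shows "z_AR A B c d U \<le> z_AR A B c d Uh"
proof (rule z_AR_greatest)
  fix x y
  assume feas: "ar_feasible A B Uh x y"
  obtain f where f: "\<And>h. h \<in> U \<Longrightarrow> f h \<in> Uh \<and> h \<le> f h"
    using assms unfolding dominates_def by metis
  have "ar_feasible A B U x (y \<circ> f)"
    using feas f unfolding ar_feasible_def by (auto intro: order_trans)
  then have "z_AR A B c d U \<le> ar_cost c d U x (y \<circ> f)"
    by (rule z_AR_le_cost)
  \<comment> \<open>The first-stage cost is unchanged, and \<open>f\<close> maps \<open>U\<close>
    into \<open>Uh\<close>, so each second-stage cost on the left also occurs on the right.\<close>
  also have "\<dots> \<le> ar_cost c d Uh x y"
    unfolding ar_cost_def by (intro add_left_mono SUP_mono) (use f in auto)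
  finally show "z_AR A B c d U \<le> ar_cost c d Uh x y" .
qed

lemma z_AR_scale_le:
  fixes U Uh :: "(real ^ 'm) set"
  assumes b: "b \<in> scalings U Uh"
  shows "z_AR A B c d Uh \<le> ereal b * z_AR A B c d U"
proof -
  have pos: "0 < b" and sub: "Uh \<subseteq> (\<lambda>h. b *\<^sub>R h) ` U"
    using b unfolding scalings_def by auto
  have U: "h /\<^sub>R b \<in> U" if "h \<in> Uh" for h
    using sub that pos by auto
  \<comment> \<open>Dividing by the finite positive \<open>b\<close> leaves a bare infimum on the
    right, so it suffices to bound the cost of each feasible pair.\<close>
  have "z_AR A B c d Uh / ereal b \<le> z_AR A B c d U"
  proof (rule z_AR_greatest)
    fix x y
    assume feas: "ar_feasible A B U x y"
    define y' where "y' h = b *\<^sub>R y (h /\<^sub>R b)" for h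
    have "h \<le> A *v (b *\<^sub>R x) + B *v y' h" if "h \<in> Uh" for h
    proof -
      have "h /\<^sub>R b \<le> A *v x + B *v y (h /\<^sub>R b)"
        using feas U[OF that] unfolding ar_feasible_def by blast
      then have "b *\<^sub>R (h /\<^sub>R b) \<le> b *\<^sub>R (A *v x + B *v y (h /\<^sub>R b))"
        using pos by (intro scaleR_left_mono) auto
      then show ?thesis
        using pos by (simp add: y'_def matrix_vector_mult_scaleR scaleR_add_right)
    qed
    moreover have "0 \<le> y' h" if "h \<in> Uh" for h
      using feas U[OF that] pos unfolding ar_feasible_def y'_def
      by (auto intro: scaleR_nonneg_nonneg)
    moreover have "0 \<le> b *\<^sub>R x"
      using feas pos unfolding ar_feasible_def by (auto intro: scaleR_nonneg_nonneg)
    ultimately have "z_AR A B c d Uh \<le> ar_cost c d Uh (b *\<^sub>R x) y'"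
      by (intro z_AR_le_cost) (auto simp: ar_feasible_def)
    \<comment> \<open>Only an inequality, since the points \<open>h /\<^sub>R b\<close> with
      \<open>h\<close> in \<open>Uh\<close> need not exhaust \<open>U\<close>.\<close>
    also have "\<dots> \<le> ereal b * ereal (c \<bullet> x) + ereal b * (SUP h\<in>U. ereal (d \<bullet> y h))"
      unfolding ar_cost_def
    proof (intro add_mono SUP_least)
      fix h
      assume "h \<in> Uh"
      then have "ereal (d \<bullet> y (h /\<^sub>R b)) \<le> (SUP h\<in>U. ereal (d \<bullet> y h))"
        by (intro SUP_upper U)
      then have "ereal b * ereal (d \<bullet> y (h /\<^sub>R b)) \<le> ereal b * (SUP h\<in>U. ereal (d \<bullet> y h))"
        using pos by (intro ereal_mult_left_mono) auto
      then show "ereal (d \<bullet> y' h) \<le> ereal b * (SUP h\<in>U. ereal (d \<bullet> y h))"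
        by (simp add: y'_def)
    qed simp
    also have "\<dots> = ereal b * ar_cost c d U x y"
      \<comment> \<open>A finite nonnegative factor distributes over the sum even when the supremum
        is infinite.\<close>
      unfolding ar_cost_def using pos by (subst ereal_pos_distrib) auto
    finally show "z_AR A B c d Uh / ereal b \<le> ar_cost c d U x y"
      using pos by (simp add: ereal_divide_le_pos)
  qed
  then show ?thesis
    using pos by (simp add: ereal_divide_le_pos)
qed

text \<open>An attained minimum is what gives \<open>LEAST\<close> its meaning; a mere infimum of
  the scalings might not itself be a scaling.\<close>

lemma scaling_factor_in_scalings:
  assumes "\<exists>b\<in>scalings U Uh. \<forall>b'\<in>scalings U Uh. b \<le> b'"
  shows "scaling_factor U Uh \<in> scalings U Uh"
proof -
  obtain b where "b \<in> scalings U Uh" and "\<And>b'. b' \<in> scalings U Uh \<Longrightarrow> b \<le> b'"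
    using assms by blast
  then show ?thesis
    unfolding scaling_factor_def by (rule LeastI2_order) simp
qed

theorem theorem2p3:
  fixes A B :: "real ^ 'n ^ 'm" and c d :: "real ^ 'n"
    and U Uh :: "(real ^ 'm) set"
  assumes "\<forall>i j. 0 \<le> A $ i $ j" and "0 \<le> c" and "0 \<le> d"
    and "assumption1 U"
    and "\<forall>h\<in>Uh. 0 \<le> h"
    and "dominates Uh U"
    and "\<exists>b\<in>scalings U Uh. \<forall>b'\<in>scalings U Uh. b \<le> b'"
  shows "z_AR A B c d U \<le> z_AR A B c d Uh \<and>
    z_AR A B c d Uh \<le> ereal (scaling_factor U Uh) * z_AR A B c d U"
  using z_AR_dominates_mono[OF assms(6)]
    z_AR_scale_le[OF scaling_factor_in_scalings[OF assms(7)]] by blast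

end
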